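(* Let $X,Y$ be complex Banach spaces and let $A\in\mathcal{L}(X,Y)$ and $B,C\in\mathcal{L}(Y,X)$ be such that $A(BA)^2=ABACA=ACABA=(AC)^2A$. Then $$\sigma_\delta(AC)=\sigma_\delta(BA).$$ In particular, $AC$ satisfies property $(\delta)$ if and only if $BA$ satisfies property $(\delta)$.
   Context: $\mathcal{L}(X,Y)$ is the set of bounded linear operators from $X$ to $Y$, and $\mathcal{L}(X)=\mathcal{L}(X,X)$. For $T\in\mathcal{L}(X)$ and a closed set $F\subseteq\mathbb{C}$, the glocal analytic spectral subspace $\mathcal{X}_T(F)$ is the linear subspace of all $x\in X$ for which there is an analytic function $f:\mathbb{C}\setminus F\to X$ with $(T-\mu)f(\mu)=x$ for all $\mu\in\mathbb{C}\setminus F$. $T$ has the decomposition property $(\delta)$ on an open set $U\subseteq\mathbb{C}$ if for all open sets $V,W\subseteq\mathbb{C}$ with $\mathbb{C}\setminus U\subseteq V\subseteq\overline{V}\subseteq W$ one has $\mathcal{X}_T(\mathbb{C}\setminus V)+\mathcal{X}_T(\overline{W})=X$. $\rho_\delta(T)$ is the largest open set on which $T$ has property $(\delta)$ (such a largest open set exists), and $\sigma_\delta(T)=\mathbb{C}\setminus\rho_\delta(T)$. $T$ has (satisfies) property $(\delta)$ if $\sigma_\delta(T)=\emptyset$. *)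

theory Defs
  imports "HOL-Analysis.Analysis"
begin

class complex_normed_vector = real_normed_vector +
  fixes scaleC :: "complex \<Rightarrow> 'a \<Rightarrow> 'a"  (infixr "*\<^sub>C" 75)
  assumes scaleC_add_right: "c *\<^sub>C (x + y) = c *\<^sub>C x + c *\<^sub>C y"
    and scaleC_add_left: "(c + d) *\<^sub>C x = c *\<^sub>C x + d *\<^sub>C x"
    and scaleC_scaleC: "c *\<^sub>C (d *\<^sub>C x) = (c * d) *\<^sub>C x"
    and scaleR_scaleC: "r *\<^sub>R x = complex_of_real r *\<^sub>C x"
    and norm_scaleC: "norm (c *\<^sub>C x) = cmod c * norm x"

class complex_banach = complex_normed_vector + banach

definition bounded_clinear ::
    "('a::complex_normed_vector \<Rightarrow> 'b::complex_normed_vector) \<Rightarrow> bool" where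
  "bounded_clinear T \<longleftrightarrow> bounded_linear T \<and> (\<forall>c x. T (c *\<^sub>C x) = c *\<^sub>C T x)"

text \<open>Analyticity of a vector-valued function on an open set \<open>S\<close>: a norm-convergent power series
  expansion around every point. The values of \<open>f\<close> outside \<open>S\<close> are irrelevant, because the radius
  may be chosen so small that the ball lies in \<open>S\<close>.\<close>

definition vector_analytic_on ::
    "(complex \<Rightarrow> 'a::complex_banach) \<Rightarrow> complex set \<Rightarrow> bool" where
  "vector_analytic_on f S \<longleftrightarrow>
     (\<forall>z\<in>S. \<exists>a r. r > 0 \<and> (\<forall>w\<in>ball z r. (\<lambda>n. (w - z) ^ n *\<^sub>C a n) sums f w))"

text \<open>Meant for closed \<open>F\<close>, so that \<open>- F\<close> is open.\<close>

definition glocal_spectral_subspace ::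
    "('a::complex_banach \<Rightarrow> 'a) \<Rightarrow> complex set \<Rightarrow> 'a set" where
  "glocal_spectral_subspace T F =
     {x. \<exists>f. vector_analytic_on f (- F) \<and> (\<forall>\<mu>\<in>- F. T (f \<mu>) - \<mu> *\<^sub>C f \<mu> = x)}"

text \<open>The sum of subspaces below is the Minkowski sum of sets.\<close>

definition decomposition_property_on ::
    "('a::complex_banach \<Rightarrow> 'a) \<Rightarrow> complex set \<Rightarrow> bool" where
  "decomposition_property_on T U \<longleftrightarrow>
     (\<forall>V W. open V \<and> open W \<and> - U \<subseteq> V \<and> V \<subseteq> closure V \<and> closure V \<subseteq> W \<longrightarrow>
        glocal_spectral_subspace T (- V) + glocal_spectral_subspace T (closure W) = UNIV)"

definition rho_delta :: "('a::complex_banach \<Rightarrow> 'a) \<Rightarrow> complex set" where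
  "rho_delta T = (GREATEST U. open U \<and> decomposition_property_on T U)"

definition sigma_delta :: "('a::complex_banach \<Rightarrow> 'a) \<Rightarrow> complex set" where
  "sigma_delta T = - rho_delta T"

definition decomposition_property :: "('a::complex_banach \<Rightarrow> 'a) \<Rightarrow> bool" where
  "decomposition_property T \<longleftrightarrow> sigma_delta T = {}"

end

theory Submission
  imports Defs
begin

text \<open>
  Write \<open>R = AC\<close> and \<open>S = BA\<close>. The hypotheses imply that \<open>AC\<close> and \<open>BA\<close> are linked by operators
  that intertwine them, and that some power of each factors through an intertwiner: \<open>P = BACAC\<close>
  satisfies \<open>SP = PR\<close> and \<open>S\<^sup>3 = PA\<close>, while \<open>Q = ABA\<close> satisfies \<open>RQ = QS\<close> and
  \<open>R\<^sup>3 = Q(BAC)\<close>. In this situation \<open>R\<close> and \<open>S\<close> have the decomposition property on the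
  same sets, because it can be carried along an intertwiner in either direction; the greatest such
  open set is then the same for both.

  So suppose that \<open>SP = PR\<close>, that the range of \<open>S\<^sup>n\<close> lies in that of \<open>P\<close>, and that every vector
  splits along the glocal subspaces of \<open>R\<close> for \<open>F\<close> and \<open>G\<close>. Given \<open>x\<close>, write \<open>S\<^sup>n x = P y\<close>, split
  \<open>y\<close>, and apply \<open>P\<close>, which maps glocal subspaces of \<open>R\<close> into those of \<open>S\<close>. This splits \<open>S\<^sup>n x\<close>,
  and the factor \<open>S\<^sup>n\<close> must be removed. Here the point \<open>0\<close> matters
  (\<open>glocal_spectral_subspace_quotient\<close>): if \<open>0 \<in> F\<close>, then \<open>S u\<close> in the subspace for \<open>F\<close> forces
  \<open>u\<close> to be there too, and if \<open>0 \<notin> G\<close>, then \<open>S\<close> maps the subspace for \<open>G\<close> onto itself. Hence if \<open>0\<close>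
  lies in exactly one of the two sets, one divides the summand for the other set by \<open>S\<^sup>n\<close> and is done
  (\<open>spectral_sum_transfer\<close>). The two closed sets of the decomposition property overlap with room to
  spare, so that one of them can be shrunk to avoid \<open>0\<close> (\<open>decomposition_property_on_transfer\<close>).
\<close>

section \<open>Scalar multiplication and power series\<close>

lemma bounded_bilinear_scaleC:
  "bounded_bilinear (scaleC :: complex \<Rightarrow> 'a::complex_normed_vector \<Rightarrow> 'a)"
proof
  fix r :: real and c :: complex and x :: 'a
  show "(r *\<^sub>R c) *\<^sub>C x = r *\<^sub>R c *\<^sub>C x"
    by (simp add: scaleR_scaleC scaleC_scaleC scaleR_conv_of_real)
  show "c *\<^sub>C r *\<^sub>R x = r *\<^sub>R c *\<^sub>C x"
    by (simp add: scaleR_scaleC scaleC_scaleC mult.commute)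
  show "\<exists>K. \<forall>c (x :: 'a). norm (c *\<^sub>C x) \<le> norm c * norm x * K"
    by (rule exI[of _ 1]) (simp add: norm_scaleC)
qed (simp_all add: scaleC_add_left scaleC_add_right)

interpretation scaleC: bounded_bilinear
  "scaleC :: complex \<Rightarrow> 'a::complex_normed_vector \<Rightarrow> 'a"
  by (rule bounded_bilinear_scaleC)

lemma scaleC_one: "1 *\<^sub>C x = (x :: 'a::complex_normed_vector)"
  using scaleR_scaleC[of 1 x] by simp

lemma scaleC_cancel:
  fixes x y :: "'a::complex_normed_vector"
  assumes "c \<noteq> 0" "c *\<^sub>C x = c *\<^sub>C y"
  shows "x = y"
proof -
  have "inverse c *\<^sub>C c *\<^sub>C x = inverse c *\<^sub>C c *\<^sub>C y"
    using assms by simp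
  then show ?thesis
    using assms(1) by (simp add: scaleC_scaleC scaleC_one)
qed

lemma power_series_coefficient_bound:
  fixes a :: "nat \<Rightarrow> 'a::complex_banach"
  assumes "\<forall>w\<in>ball z r. (\<lambda>n. (w - z) ^ n *\<^sub>C a n) sums f w" "0 \<le> \<rho>" "\<rho> < r"
  obtains M where "M > 0" "\<And>n. norm (a n) * \<rho> ^ n \<le> M"
proof -
  have "z + of_real \<rho> \<in> ball z r"
    using assms by (simp add: dist_norm)
  with assms(1) have "summable (\<lambda>n. (of_real \<rho> :: complex) ^ n *\<^sub>C a n)"
    by (force simp: sums_iff)
  then have "Bseq (\<lambda>n. (of_real \<rho> :: complex) ^ n *\<^sub>C a n)"
    by (intro convergent_imp_Bseq convergentI[OF summable_LIMSEQ_zero])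
  then obtain M where "M > 0" "\<And>n. norm ((of_real \<rho> :: complex) ^ n *\<^sub>C a n) \<le> M"
    by (auto simp: Bseq_def)
  then show ?thesis
    using that assms(2) by (auto simp: norm_scaleC norm_power mult.commute)
qed

lemma power_series_at_center:
  fixes a :: "nat \<Rightarrow> 'a::complex_banach"
  assumes "(\<lambda>n. (z - z) ^ n *\<^sub>C a n) sums y"
  shows "y = a 0"
proof -
  have "(\<lambda>n. (z - z) ^ n *\<^sub>C a n) = (\<lambda>n. if n = 0 then a n else 0)"
    by (auto simp: scaleC_one scaleC.zero_left fun_eq_iff power_0_left)
  with assms show ?thesis
    using sums_single[of 0 a] sums_unique2 by auto
qed

lemma power_series_minus_constant:
  fixes a :: "nat \<Rightarrow> 'a::complex_banach"
  assumes "(\<lambda>n. t ^ n *\<^sub>C a n) sums y"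
  shows "(\<lambda>n. t ^ n *\<^sub>C (a(0 := a 0 - c)) n) sums (y - c)"
proof -
  have "(\<lambda>n. t ^ n *\<^sub>C (a(0 := a 0 - c)) n) =
      (\<lambda>n. t ^ n *\<^sub>C a n - (if n = 0 then c else 0))"
    by (auto simp: fun_eq_iff scaleC_one)
  then show ?thesis
    using sums_diff[OF assms sums_single[of 0 "\<lambda>_. c"]] by simp
qed

section \<open>Vector-valued analytic functions\<close>

lemma vector_analytic_on_isCont:
  fixes f :: "complex \<Rightarrow> 'a::complex_banach"
  assumes "vector_analytic_on f S" "z \<in> S"
  shows "isCont f z"
proof -
  obtain a r where "r > 0"
    and ser: "\<forall>w\<in>ball z r. (\<lambda>n. (w - z) ^ n *\<^sub>C a n) sums f w"
    using assms unfolding vector_analytic_on_def by meson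
  define \<rho> where "\<rho> = r / 2"
  have \<rho>: "0 < \<rho>" "\<rho> < r"
    using \<open>r > 0\<close> by (auto simp: \<rho>_def)
  obtain M where M: "M > 0" "\<And>n. norm (a n) * \<rho> ^ n \<le> M"
    using power_series_coefficient_bound[OF ser less_imp_le] \<rho> by blast
  have fz: "f z = a 0"
    by (rule power_series_at_center, rule bspec[OF ser]) (simp add: \<open>r > 0\<close>)
  \<comment> \<open>Comparing the tail with a geometric series gives a Lipschitz estimate at the center.\<close>
  have bound: "norm (f w - f z) \<le> 2 * M / \<rho> * norm (w - z)" if w: "norm (w - z) \<le> \<rho> / 2" for w
  proof -
    define t where "t = w - z"
    have "w \<in> ball z r"
      using w \<rho> by (simp add: dist_norm norm_minus_commute)
    with ser have "(\<lambda>n. t ^ n *\<^sub>C a n) sums f w"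
      by (auto simp: t_def)
    then have tail: "(\<lambda>n. t ^ Suc n *\<^sub>C a (Suc n)) sums (f w - f z)"
      by (subst sums_Suc_iff) (simp add: fz scaleC_one)
    have geo: "(\<lambda>n. norm t * (M / \<rho>) * (1 / 2) ^ n) sums (norm t * (M / \<rho>) * 2)"
      using geometric_sums[of "1 / 2 :: real"] by (intro sums_mult) simp
    have "norm (t ^ Suc n *\<^sub>C a (Suc n)) \<le> norm t * (M / \<rho>) * (1 / 2) ^ n" for n
    proof -
      have "norm (a (Suc n)) \<le> M / \<rho> ^ Suc n"
        using M(2)[of "Suc n"] \<rho> by (simp add: field_simps)
      moreover have "norm t ^ n \<le> (\<rho> / 2) ^ n"
        using w by (intro power_mono) (auto simp: t_def)
      ultimately have "norm t * norm t ^ n * norm (a (Suc n)) \<le>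
          norm t * (\<rho> / 2) ^ n * (M / \<rho> ^ Suc n)"
        using \<rho> by (intro mult_mono) auto
      also have "\<dots> = norm t * (M / \<rho>) * (1 / 2) ^ n"
        using \<rho> by (simp add: field_simps)
      finally show ?thesis
        by (simp add: norm_scaleC norm_power norm_mult)
    qed
    then have "norm (\<Sum>n. t ^ Suc n *\<^sub>C a (Suc n)) \<le> (\<Sum>n. norm t * (M / \<rho>) * (1 / 2) ^ n)"
      by (intro norm_suminf_le sums_summable[OF geo])
    then show ?thesis
      using sums_unique[OF tail] sums_unique[OF geo] by (simp add: t_def mult_ac)
  qed
  have "((\<lambda>w. f w - f z) \<longlongrightarrow> 0) (at z)"
  proof (rule Lim_null_comparison)
    have "\<forall>\<^sub>F w in at z. norm (w - z) \<le> \<rho> / 2"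
      unfolding eventually_at dist_norm using \<rho>(1) by (intro exI[of _ "\<rho> / 2"]) auto
    then show "\<forall>\<^sub>F w in at z. norm (f w - f z) \<le> 2 * M / \<rho> * norm (w - z)"
      by eventually_elim (rule bound)
    show "((\<lambda>w. 2 * M / \<rho> * norm (w - z)) \<longlongrightarrow> 0) (at z)"
      by (rule tendsto_eq_rhs, (rule tendsto_intros)+, simp)
  qed
  then show ?thesis
    unfolding isCont_def by (simp add: LIM_zero_iff)
qed

lemma vector_analytic_on_diff_const:
  assumes "vector_analytic_on f S"
  shows "vector_analytic_on (\<lambda>w. f w - c) S"
  unfolding vector_analytic_on_def
proof
  fix z assume "z \<in> S"
  then obtain a r where "r > 0" "\<forall>w\<in>ball z r. (\<lambda>n. (w - z) ^ n *\<^sub>C a n) sums f w"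
    using assms unfolding vector_analytic_on_def by meson
  then show "\<exists>a r. r > 0 \<and> (\<forall>w\<in>ball z r. (\<lambda>n. (w - z) ^ n *\<^sub>C a n) sums (f w - c))"
    by (intro exI[of _ "a(0 := a 0 - c)"] exI[of _ r] conjI ballI power_series_minus_constant)
      blast+
qed

lemma vector_analytic_on_bounded_clinear:
  assumes "bounded_clinear P" "vector_analytic_on f S"
  shows "vector_analytic_on (\<lambda>w. P (f w)) S"
  unfolding vector_analytic_on_def
proof
  fix z assume "z \<in> S"
  then obtain a r where "r > 0"
    and ser: "\<forall>w\<in>ball z r. (\<lambda>n. (w - z) ^ n *\<^sub>C a n) sums f w"
    using assms unfolding vector_analytic_on_def by meson
  have "(\<lambda>n. (w - z) ^ n *\<^sub>C P (a n)) sums P (f w)" if "w \<in> ball z r" for w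
  proof -
    have "bounded_linear P"
      using assms(1) by (simp add: bounded_clinear_def)
    then have "(\<lambda>n. P ((w - z) ^ n *\<^sub>C a n)) sums P (f w)"
      using bspec[OF ser that] by (rule bounded_linear.sums)
    then show ?thesis
      using assms(1) by (simp add: bounded_clinear_def)
  qed
  with \<open>r > 0\<close> show "\<exists>a r. r > 0 \<and> (\<forall>w\<in>ball z r. (\<lambda>n. (w - z) ^ n *\<^sub>C a n) sums P (f w))"
    by (intro exI[of _ "\<lambda>n. P (a n)"] exI[of _ r] conjI ballI)
qed

text \<open>The coefficients \<open>c\<close> of the quotient \<open>f(w) / w\<close> around \<open>z \<noteq> 0\<close> are found by comparing
  coefficients in \<open>(z + (w - z)) \<Sum>\<^sub>n c\<^sub>n (w - z)\<^sup>n = \<Sum>\<^sub>n a\<^sub>n (w - z)\<^sup>n\<close>. A partial sum of the quotient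
  series times \<open>w\<close> differs from that of \<open>f\<close> by a single boundary term.\<close>

lemma power_series_divide_by_argument:
  fixes a :: "nat \<Rightarrow> 'a::complex_banach"
  assumes "r > 0" "z \<noteq> 0"
    and ser: "\<forall>w\<in>ball z r. (\<lambda>n. (w - z) ^ n *\<^sub>C a n) sums f w"
  obtains c s where "s > 0"
    "\<forall>w\<in>ball z s. w \<noteq> 0 \<and> (\<lambda>n. (w - z) ^ n *\<^sub>C c n) sums (inverse w *\<^sub>C f w)"
proof -
  define s where "s = min (r / 2) (norm z / 2)"
  have s: "0 < s" "s < r" "s \<le> norm z / 2"
    using assms by (auto simp: s_def)
  obtain M where M: "M > 0" "\<And>n. norm (a n) * s ^ n \<le> M"
    using power_series_coefficient_bound[OF ser less_imp_le] s by blast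
  define c where "c = rec_nat (inverse z *\<^sub>C a 0) (\<lambda>n y. inverse z *\<^sub>C (a (Suc n) - y))"
  have c0: "z *\<^sub>C c 0 = a 0" and cSuc: "z *\<^sub>C c (Suc n) = a (Suc n) - c n" for n
    using \<open>z \<noteq> 0\<close> by (simp_all add: c_def scaleC_scaleC scaleC_one)
  \<comment> \<open>Since \<open>s \<le> \<bar>z\<bar> / 2\<close>, each step of the recursion contracts by a factor \<open>1 / 2\<close>, so that the
    bound \<open>M\<close> on the coefficients of \<open>f\<close> yields twice the bound \<open>M / \<bar>z\<bar>\<close>.\<close>
  have cbound: "norm z * norm (c n) * s ^ n \<le> 2 * M" for n
  proof (induction n)
    case 0
    have "norm z * norm (c 0) = norm (a 0)"
      by (metis c0 norm_scaleC)
    then show ?case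
      using M(1) M(2)[of 0] by simp
  next
    case (Suc n)
    have "norm z * norm (c (Suc n)) = norm (a (Suc n) - c n)"
      by (metis cSuc norm_scaleC)
    also have "\<dots> \<le> norm (a (Suc n)) + norm (c n)"
      by (rule norm_triangle_ineq4)
    finally have "norm z * norm (c (Suc n)) * s ^ Suc n \<le>
        (norm (a (Suc n)) + norm (c n)) * s ^ Suc n"
      using s by (intro mult_right_mono) auto
    also have "\<dots> = norm (a (Suc n)) * s ^ Suc n + s * (norm (c n) * s ^ n)"
      by (simp add: algebra_simps)
    also have "s * (norm (c n) * s ^ n) \<le> norm z / 2 * (norm (c n) * s ^ n)"
      using s by (intro mult_right_mono) auto
    also have "norm z / 2 * (norm (c n) * s ^ n) \<le> M"
      using Suc by simp
    finally show ?case
      using M(2)[of "Suc n"] by linarith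
  qed
  have "w \<noteq> 0 \<and> (\<lambda>n. (w - z) ^ n *\<^sub>C c n) sums (inverse w *\<^sub>C f w)" if w: "w \<in> ball z s" for w
  proof -
    define t where "t = w - z"
    have t: "norm t < s"
      using w by (simp add: t_def dist_norm norm_minus_commute)
    have "w \<noteq> 0"
      using w s \<open>z \<noteq> 0\<close> by (auto simp: dist_norm)
    have wt: "w = z + t"
      by (simp add: t_def)
    have partial: "w *\<^sub>C (\<Sum>n<Suc N. t ^ n *\<^sub>C c n) =
        (\<Sum>n<Suc N. t ^ n *\<^sub>C a n) + t ^ Suc N *\<^sub>C c N" for N
    proof (induction N)
      case 0
      then show ?case
        by (simp add: scaleC_one wt scaleC_add_left c0)
    next
      case (Suc N)
      have "w *\<^sub>C (t ^ Suc N *\<^sub>C c (Suc N)) =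
          t ^ Suc N *\<^sub>C (z *\<^sub>C c (Suc N)) + t ^ Suc (Suc N) *\<^sub>C c (Suc N)"
        by (simp add: wt scaleC_scaleC scaleC_add_left[symmetric] algebra_simps)
      with Suc show ?case
        by (simp only: sum.lessThan_Suc[of _ "Suc N"] scaleC_add_right cSuc scaleC.diff_right)
          (simp add: algebra_simps)
    qed
    have "(\<lambda>N. 2 * M / norm z * norm t * (norm t / s) ^ N) \<longlonglongrightarrow> 0"
      using t s by (intro tendsto_mult_right_zero LIMSEQ_power_zero) auto
    moreover have "norm (t ^ Suc N *\<^sub>C c N) \<le> 2 * M / norm z * norm t * (norm t / s) ^ N" for N
    proof -
      have "norm (c N) \<le> 2 * M / (norm z * s ^ N)"
        using cbound[of N] s \<open>z \<noteq> 0\<close> by (simp add: field_simps)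
      then have "norm t ^ Suc N * norm (c N) \<le> norm t ^ Suc N * (2 * M / (norm z * s ^ N))"
        by (intro mult_left_mono) auto
      then show ?thesis
        by (simp add: norm_scaleC norm_power norm_mult power_divide mult_ac)
    qed
    ultimately have boundary: "(\<lambda>N. t ^ Suc N *\<^sub>C c N) \<longlonglongrightarrow> 0"
      by (rule Lim_null_comparison[OF always_eventually, OF allI, rotated])
    have "(\<lambda>n. t ^ n *\<^sub>C a n) sums f w"
      using ser w s by (auto simp: t_def)
    then have "(\<lambda>N. \<Sum>n<Suc N. t ^ n *\<^sub>C a n) \<longlonglongrightarrow> f w"
      unfolding sums_def by (rule LIMSEQ_Suc)
    from tendsto_add[OF this boundary]
    have "(\<lambda>N. w *\<^sub>C (\<Sum>n<Suc N. t ^ n *\<^sub>C c n)) \<longlonglongrightarrow> f w"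
      by (simp only: partial add_0_right)
    from scaleC.tendsto[OF tendsto_const[of "inverse w"] this]
    have "(\<lambda>N. \<Sum>n<Suc N. t ^ n *\<^sub>C c n) \<longlonglongrightarrow> inverse w *\<^sub>C f w"
      using \<open>w \<noteq> 0\<close> by (simp add: scaleC_scaleC scaleC_one del: sum.lessThan_Suc)
    then show ?thesis
      using \<open>w \<noteq> 0\<close> LIMSEQ_imp_Suc[of "\<lambda>N. \<Sum>n<N. t ^ n *\<^sub>C c n"]
      by (simp add: sums_def t_def del: sum.lessThan_Suc)
  qed
  then have "\<forall>w\<in>ball z s. w \<noteq> 0 \<and> (\<lambda>n. (w - z) ^ n *\<^sub>C c n) sums (inverse w *\<^sub>C f w)"
    by (rule ballI)
  with s(1) show ?thesis
    by (rule that)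
qed

lemma vector_analytic_on_divide_by_argument:
  fixes f :: "complex \<Rightarrow> 'a::complex_banach"
  assumes f: "vector_analytic_on f S" and f0: "0 \<in> S \<Longrightarrow> f 0 = 0"
  shows "\<exists>g. vector_analytic_on g S \<and> (\<forall>w\<in>S. f w = w *\<^sub>C g w)"
proof -
  \<comment> \<open>At \<open>0\<close> the quotient has to take the value of the first Taylor coefficient.\<close>
  obtain a r where ser: "0 \<in> S \<Longrightarrow> r > 0"
      "0 \<in> S \<Longrightarrow> \<forall>w\<in>ball 0 r. (\<lambda>n. (w - 0) ^ n *\<^sub>C a n) sums f w"
    using f unfolding vector_analytic_on_def by meson
  define g where "g w = (if w = 0 then a 1 else inverse w *\<^sub>C f w)" for w
  have "\<exists>c s. s > 0 \<and> (\<forall>w\<in>ball z s. (\<lambda>n. (w - z) ^ n *\<^sub>C c n) sums g w)" if z: "z \<in> S" for z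
  proof (cases "z = 0")
    case False
    obtain b q where "q > 0" "\<forall>w\<in>ball z q. (\<lambda>n. (w - z) ^ n *\<^sub>C b n) sums f w"
      using bspec[OF f[unfolded vector_analytic_on_def] z] by blast
    then obtain c s where "s > 0"
      "\<forall>w\<in>ball z s. w \<noteq> 0 \<and> (\<lambda>n. (w - z) ^ n *\<^sub>C c n) sums (inverse w *\<^sub>C f w)"
      using power_series_divide_by_argument[OF _ False] by blast
    then show ?thesis
      by (intro exI[of _ c] exI[of _ s]) (simp add: g_def)
  next
    case True
    with z have S: "0 \<in> S"
      by simp
    have a0: "a 0 = 0"
      by (rule power_series_at_center[symmetric, of 0], subst f0[OF S, symmetric],
          rule bspec[OF ser(2)[OF S]]) (simp add: ser(1)[OF S])
    have "(\<lambda>n. w ^ n *\<^sub>C a (Suc n)) sums g w" if w: "w \<in> ball 0 r" for w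
    proof (cases "w = 0")
      case True
      have "(\<lambda>n. w ^ n *\<^sub>C a (Suc n)) = (\<lambda>n. if n = 0 then a (Suc n) else 0)"
        using True by (auto simp: scaleC_one scaleC.zero_left fun_eq_iff power_0_left)
      then show ?thesis
        using sums_single[of 0 "\<lambda>n. a (Suc n)"] True by (simp add: g_def)
    next
      case False
      have "(\<lambda>n. w ^ n *\<^sub>C a n) sums f w"
        using ser(2)[OF S] w by simp
      then have "(\<lambda>n. w ^ Suc n *\<^sub>C a (Suc n)) sums f w"
        by (subst sums_Suc_iff) (simp add: a0 scaleC.zero_right)
      from bounded_linear.sums[OF scaleC.bounded_linear_right this, of "inverse w"] False
      show ?thesis
        by (simp add: g_def scaleC_scaleC mult.assoc[symmetric])
    qed
    then show ?thesis
      using True ser(1)[OF S] by (intro exI[of _ "\<lambda>n. a (Suc n)"] exI[of _ r]) simp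
  qed
  then have "vector_analytic_on g S"
    by (simp add: vector_analytic_on_def)
  moreover have "f w = w *\<^sub>C g w" if "w \<in> S" for w
    using f0 that by (auto simp: g_def scaleC_scaleC scaleC_one scaleC.zero_left)
  ultimately show ?thesis
    by blast
qed

section \<open>Glocal spectral subspaces and the point zero\<close>

lemma glocal_spectral_subspace_mono:
  assumes "F \<subseteq> G"
  shows "glocal_spectral_subspace T F \<subseteq> glocal_spectral_subspace T G"
proof
  fix x assume "x \<in> glocal_spectral_subspace T F"
  then obtain f where "vector_analytic_on f (- F)" "\<forall>\<mu>\<in>- F. T (f \<mu>) - \<mu> *\<^sub>C f \<mu> = x"
    by (auto simp: glocal_spectral_subspace_def)
  moreover have "- G \<subseteq> - F"
    using assms by blast
  ultimately show "x \<in> glocal_spectral_subspace T G"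
    unfolding glocal_spectral_subspace_def vector_analytic_on_def
    by (intro CollectI exI[of _ f]) (simp add: subset_iff)
qed

lemma glocal_spectral_subspace_intertwine:
  assumes P: "bounded_clinear P" "S \<circ> P = P \<circ> R" and y: "y \<in> glocal_spectral_subspace R F"
  shows "P y \<in> glocal_spectral_subspace S F"
proof -
  obtain f where f: "vector_analytic_on f (- F)" "\<forall>\<mu>\<in>- F. R (f \<mu>) - \<mu> *\<^sub>C f \<mu> = y"
    using y by (auto simp: glocal_spectral_subspace_def)
  have SP: "S (P v) = P (R v)" for v
    using P(2) by (simp add: fun_eq_iff)
  have "S (P (f \<mu>)) - \<mu> *\<^sub>C P (f \<mu>) = P (R (f \<mu>) - \<mu> *\<^sub>C f \<mu>)" for \<mu>
    using P(1) unfolding bounded_clinear_def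
    by (simp add: SP linear_diff bounded_linear.linear)
  with f(2) have "\<forall>\<mu>\<in>- F. S (P (f \<mu>)) - \<mu> *\<^sub>C P (f \<mu>) = P y"
    by simp
  with vector_analytic_on_bounded_clinear[OF P(1) f(1)] show ?thesis
    unfolding glocal_spectral_subspace_def by blast
qed

text \<open>If \<open>(S - \<mu>) f(\<mu>) = S x\<close>, then \<open>(S - \<mu>) (f(\<mu>) - x) = \<mu> x\<close>, so that \<open>(f(\<mu>) - x) / \<mu>\<close> is the
  function required for \<open>x\<close>. The singularity at \<open>0\<close> either lies in \<open>F\<close> or is removable because
  \<open>f 0 = x\<close>; in the latter case the equation at \<open>0\<close> follows by continuity.\<close>

lemma glocal_spectral_subspace_quotient:
  assumes "closed F" and S: "bounded_clinear S"
    and f: "vector_analytic_on f (- F)" "\<forall>\<mu>\<in>- F. S (f \<mu>) - \<mu> *\<^sub>C f \<mu> = S x"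
    and f0: "0 \<notin> F \<Longrightarrow> f 0 = x"
  shows "x \<in> glocal_spectral_subspace S F"
proof -
  have "vector_analytic_on (\<lambda>\<mu>. f \<mu> - x) (- F)"
    by (rule vector_analytic_on_diff_const[OF f(1)])
  then have "\<exists>g. vector_analytic_on g (- F) \<and> (\<forall>\<mu>\<in>- F. f \<mu> - x = \<mu> *\<^sub>C g \<mu>)"
    by (rule vector_analytic_on_divide_by_argument) (simp add: f0)
  then obtain g where g: "vector_analytic_on g (- F)"
    "\<And>\<mu>. \<mu> \<in> - F \<Longrightarrow> f \<mu> - x = \<mu> *\<^sub>C g \<mu>"
    by blast
  have lin: "linear S" and bl: "bounded_linear S" and hom: "\<And>c v. S (c *\<^sub>C v) = c *\<^sub>C S v"
    using S by (auto simp: bounded_clinear_def bounded_linear.linear)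
  have nonzero: "S (g \<mu>) - \<mu> *\<^sub>C g \<mu> = x" if "\<mu> \<in> - F" "\<mu> \<noteq> 0" for \<mu>
  proof (rule scaleC_cancel[OF \<open>\<mu> \<noteq> 0\<close>])
    have "\<mu> *\<^sub>C (S (g \<mu>) - \<mu> *\<^sub>C g \<mu>) = S (\<mu> *\<^sub>C g \<mu>) - \<mu> *\<^sub>C \<mu> *\<^sub>C g \<mu>"
      by (simp add: hom scaleC.diff_right)
    also have "\<dots> = (S (f \<mu>) - \<mu> *\<^sub>C f \<mu>) - S x + \<mu> *\<^sub>C x"
      using g(2)[OF that(1), symmetric] by (simp add: linear_diff[OF lin] scaleC.diff_right)
    finally show "\<mu> *\<^sub>C (S (g \<mu>) - \<mu> *\<^sub>C g \<mu>) = \<mu> *\<^sub>C x"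
      using f(2) that(1) by simp
  qed
  have "S (g 0) - 0 *\<^sub>C g 0 = x" if "0 \<in> - F"
  proof -
    have "(g \<longlongrightarrow> g 0) (at 0)"
      using vector_analytic_on_isCont[OF g(1) that] by (simp add: isCont_def)
    then have "((\<lambda>\<mu>. S (g \<mu>) - \<mu> *\<^sub>C g \<mu>) \<longlongrightarrow> S (g 0) - 0 *\<^sub>C g 0) (at 0)"
      by (intro tendsto_diff bounded_linear.tendsto[OF bl] scaleC.tendsto tendsto_ident_at)
    moreover have "\<forall>\<^sub>F \<mu> in at 0. \<mu> \<in> - F"
      using \<open>closed F\<close> that by (intro eventually_at_in_open') (auto simp: open_Compl)
    then have "\<forall>\<^sub>F \<mu> in at 0. S (g \<mu>) - \<mu> *\<^sub>C g \<mu> = x"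
      using eventually_neq_at_within[of 0 0 UNIV]
      by eventually_elim (simp add: nonzero)
    then have "((\<lambda>\<mu>. S (g \<mu>) - \<mu> *\<^sub>C g \<mu>) \<longlongrightarrow> x) (at 0)"
      by (rule tendsto_eventually)
    ultimately show ?thesis
      by (rule tendsto_unique[OF at_neq_bot])
  qed
  with nonzero g(1) show ?thesis
    unfolding glocal_spectral_subspace_def by (intro CollectI exI[of _ g]) metis
qed

lemma glocal_spectral_subspace_cancel_funpow:
  assumes "closed F" "bounded_clinear S" "0 \<in> F"
    and "(S ^^ n) x \<in> glocal_spectral_subspace S F"
  shows "x \<in> glocal_spectral_subspace S F"
  using assms(4)
proof (induction n)
  case (Suc n)
  then obtain f where "vector_analytic_on f (- F)"
    "\<forall>\<mu>\<in>- F. S (f \<mu>) - \<mu> *\<^sub>C f \<mu> = S ((S ^^ n) x)"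
    by (auto simp: glocal_spectral_subspace_def)
  then have "(S ^^ n) x \<in> glocal_spectral_subspace S F"
    using assms by (intro glocal_spectral_subspace_quotient[of F S f]) auto
  then show ?case
    by (rule Suc.IH)
qed simp

text \<open>If \<open>0 \<notin> F\<close>, then \<open>x = S (f 0)\<close>, and \<open>f 0\<close> is again in the subspace.\<close>

lemma glocal_spectral_subspace_funpow_preimage:
  assumes "closed F" "bounded_clinear S" "0 \<notin> F"
    and "x \<in> glocal_spectral_subspace S F"
  shows "\<exists>u\<in>glocal_spectral_subspace S F. (S ^^ n) u = x"
proof (induction n)
  case 0
  then show ?case
    using assms(4) by simp
next
  case (Suc n)
  then obtain u where u: "u \<in> glocal_spectral_subspace S F" "(S ^^ n) u = x"
    by blast
  then obtain f where f: "vector_analytic_on f (- F)" "\<forall>\<mu>\<in>- F. S (f \<mu>) - \<mu> *\<^sub>C f \<mu> = u"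
    by (auto simp: glocal_spectral_subspace_def)
  then have Sf0: "S (f 0) = u"
    using bspec[OF f(2), of 0] assms(3) by (simp add: scaleC.zero_left)
  with f have "f 0 \<in> glocal_spectral_subspace S F"
    using assms by (intro glocal_spectral_subspace_quotient[of F S f]) auto
  with Sf0 u(2) show ?case
    by (auto simp: funpow_swap1 intro!: bexI[of _ "f 0"])
qed

section \<open>Transfer of the decomposition property\<close>

lemma spectral_sum_transfer:
  fixes S :: "'x::complex_banach \<Rightarrow> 'x" and R :: "'y::complex_banach \<Rightarrow> 'y"
  assumes S: "bounded_clinear S" and P: "bounded_clinear P"
    and SP: "S \<circ> P = P \<circ> R" and range: "range (S ^^ n) \<subseteq> range P"
    and F: "closed F" "0 \<in> F" and G: "closed G" "0 \<notin> G"
    and sum: "glocal_spectral_subspace R F + glocal_spectral_subspace R G = UNIV"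
  shows "glocal_spectral_subspace S F + glocal_spectral_subspace S G = UNIV"
proof -
  have "x \<in> glocal_spectral_subspace S F + glocal_spectral_subspace S G" for x
  proof -
    obtain y where y: "(S ^^ n) x = P y"
      using range by blast
    have "y \<in> glocal_spectral_subspace R F + glocal_spectral_subspace R G"
      using sum by simp
    then obtain y1 y2 where y12: "y1 \<in> glocal_spectral_subspace R F"
      "y2 \<in> glocal_spectral_subspace R G" "y = y1 + y2"
      by (elim set_plus_elim)
    have Py: "P y1 \<in> glocal_spectral_subspace S F" "P y2 \<in> glocal_spectral_subspace S G"
      using y12 by (auto intro: glocal_spectral_subspace_intertwine[OF P SP])
    then obtain x2 where x2: "x2 \<in> glocal_spectral_subspace S G" "(S ^^ n) x2 = P y2"
      using glocal_spectral_subspace_funpow_preimage[OF G(1) S G(2)] by blast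
    have "linear (S ^^ n)"
    proof (induction n)
      case (Suc n)
      then show ?case
        using S linear_compose[of "S ^^ n" S]
        by (simp add: bounded_clinear_def bounded_linear.linear o_def)
    qed (simp add: linear_id id_def[symmetric])
    moreover have "linear P"
      using P by (simp add: bounded_clinear_def bounded_linear.linear)
    ultimately have "(S ^^ n) (x - x2) = P y1"
      by (simp add: linear_diff linear_add y y12(3) x2(2))
    with Py(1) have "x - x2 \<in> glocal_spectral_subspace S F"
      using glocal_spectral_subspace_cancel_funpow[OF F(1) S F(2)] by metis
    from set_plus_intro[OF this x2(1)] show ?thesis
      by simp
  qed
  then show ?thesis
    by blast
qed

text \<open>Enlarging \<open>V\<close> or shrinking \<open>W\<close> by a small disc around \<open>0\<close> shrinks the two closed sets
  \<open>- V\<close> and \<open>closure W\<close> so that \<open>0\<close> remains in only one of them, while the pair stays admissible.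
  Which of the two changes is possible depends on whether \<open>0 \<in> W\<close>.\<close>

lemma decomposition_property_on_transfer:
  fixes S :: "'x::complex_banach \<Rightarrow> 'x" and R :: "'y::complex_banach \<Rightarrow> 'y"
  assumes S: "bounded_clinear S" and P: "bounded_clinear P"
    and SP: "S \<circ> P = P \<circ> R" and range: "range (S ^^ n) \<subseteq> range P"
    and R: "decomposition_property_on R U"
  shows "decomposition_property_on S U"
  unfolding decomposition_property_on_def
proof (intro allI impI)
  fix V W assume VW: "open V \<and> open W \<and> - U \<subseteq> V \<and> V \<subseteq> closure V \<and> closure V \<subseteq> W"
  note transfer = spectral_sum_transfer[OF S P SP range]
  obtain V' W' where V': "open V'" "V \<subseteq> V'" and W': "open W'" "W' \<subseteq> W"
    and sub: "closure V' \<subseteq> W'"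
    and zero: "0 \<in> V' \<and> 0 \<in> W' \<or> 0 \<notin> V' \<and> 0 \<notin> closure W'"
  proof (cases "0 \<in> W")
    case True
    then obtain r where "r > 0" "cball 0 r \<subseteq> W"
      using VW open_contains_cball by blast
    then show ?thesis
      using that[of "V \<union> ball 0 r" W] True VW by (auto simp: closure_Un)
  next
    case False
    then have "0 \<in> - closure V"
      using VW by auto
    then obtain r where r: "r > 0" "cball 0 r \<subseteq> - closure V"
      by (meson open_contains_cball open_Compl closed_closure)
    have "ball 0 r \<inter> closure (W - cball 0 r) = {}"
      by (subst open_Int_closure_eq_empty) auto
    with r have "0 \<notin> closure (W - cball 0 r)"
      by (meson centre_in_ball disjoint_iff)
    then show ?thesis
      using that[of V "W - cball 0 r"] False VW r by (auto intro: open_Diff)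
  qed
  have "glocal_spectral_subspace R (- V') + glocal_spectral_subspace R (closure W') = UNIV"
    using R V' W' sub VW closure_subset unfolding decomposition_property_on_def
    by (meson order_trans)
  then have "glocal_spectral_subspace S (- V') + glocal_spectral_subspace S (closure W') = UNIV"
    using zero
  proof (elim disjE)
    assume sum: "glocal_spectral_subspace R (- V') + glocal_spectral_subspace R (closure W') = UNIV"
      and "0 \<in> V' \<and> 0 \<in> W'"
    then have "0 \<in> closure W'"
      using closure_subset by blast
    then show ?thesis
      using transfer[of "closure W'" "- V'"] sum V'(1) \<open>0 \<in> V' \<and> 0 \<in> W'\<close>
      by (simp add: add.commute closed_Compl)
  next
    assume "glocal_spectral_subspace R (- V') + glocal_spectral_subspace R (closure W') = UNIV"
      and "0 \<notin> V' \<and> 0 \<notin> closure W'"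
    then show ?thesis
      using transfer[of "- V'" "closure W'"] V'(1) by (simp add: closed_Compl)
  qed
  moreover have "glocal_spectral_subspace S (- V') + glocal_spectral_subspace S (closure W') \<subseteq>
      glocal_spectral_subspace S (- V) + glocal_spectral_subspace S (closure W)"
    using V' W' by (intro set_plus_mono2 glocal_spectral_subspace_mono closure_mono) auto
  ultimately show
    "glocal_spectral_subspace S (- V) + glocal_spectral_subspace S (closure W) = UNIV"
    by blast
qed

lemma bounded_clinear_compose:
  assumes "bounded_clinear S" "bounded_clinear T"
  shows "bounded_clinear (S \<circ> T)"
  using assms unfolding bounded_clinear_def o_def by (auto intro: bounded_linear_compose)

theorem theorem2p3:
  fixes A :: "'x::complex_banach \<Rightarrow> 'y::complex_banach"
    and B C :: "'y \<Rightarrow> 'x"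
  assumes "bounded_clinear A" and "bounded_clinear B" and "bounded_clinear C"
    and "A \<circ> (B \<circ> A) ^^ 2 = A \<circ> B \<circ> A \<circ> C \<circ> A"
    and "A \<circ> B \<circ> A \<circ> C \<circ> A = A \<circ> C \<circ> A \<circ> B \<circ> A"
    and "A \<circ> C \<circ> A \<circ> B \<circ> A = (A \<circ> C) ^^ 2 \<circ> A"
  shows "sigma_delta (A \<circ> C) = sigma_delta (B \<circ> A) \<and>
    (decomposition_property (A \<circ> C) \<longleftrightarrow> decomposition_property (B \<circ> A))"
proof -
  have words: "A (B (A (B (A x)))) = A (C (A (C (A x))))"
      "A (B (A (C (A x)))) = A (C (A (C (A x))))"
      "A (C (A (B (A x)))) = A (C (A (C (A x))))" for x
    using assms(4-6) by (simp_all add: fun_eq_iff numeral_2_eq_2)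
  note bcl = bounded_clinear_compose assms(1-3)
  have "decomposition_property_on (A \<circ> C) U \<longleftrightarrow> decomposition_property_on (B \<circ> A) U" for U
  proof
    assume "decomposition_property_on (A \<circ> C) U"
    then show "decomposition_property_on (B \<circ> A) U"
    proof (rule decomposition_property_on_transfer[where P = "B \<circ> A \<circ> C \<circ> A \<circ> C" and n = 3, rotated 4])
      have "((B \<circ> A) ^^ 3) x = (B \<circ> A \<circ> C \<circ> A \<circ> C) (A x)" for x
        by (simp add: numeral_3_eq_3 words)
      then show "range ((B \<circ> A) ^^ 3) \<subseteq> range (B \<circ> A \<circ> C \<circ> A \<circ> C)"
        by (metis image_subsetI rangeI)
    qed (auto simp: fun_eq_iff words intro!: bcl)
  next
    assume "decomposition_property_on (B \<circ> A) U"
    then show "decomposition_property_on (A \<circ> C) U"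
    proof (rule decomposition_property_on_transfer[where P = "A \<circ> B \<circ> A" and n = 3, rotated 4])
      have "((A \<circ> C) ^^ 3) y = (A \<circ> B \<circ> A) (B (A (C y)))" for y
        by (simp add: numeral_3_eq_3 words)
      then show "range ((A \<circ> C) ^^ 3) \<subseteq> range (A \<circ> B \<circ> A)"
        by (metis image_subsetI rangeI)
    qed (auto simp: fun_eq_iff words intro!: bcl)
  qed
  then have "sigma_delta (A \<circ> C) = sigma_delta (B \<circ> A)"
    by (simp add: sigma_delta_def rho_delta_def)
  then show ?thesis
    by (simp add: decomposition_property_def)
qed

end
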